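(* Let $n\geq 2$, let $E$ and $F$ be two real inner product spaces, and let $\phi\colon E\to F$ be a surjective map such that for all $x_0,x_1,\dots,x_n\in E$ \[ \mathrm{Vol}_n(x_1-x_0,\dots,x_n-x_0)=1 \iff \mathrm{Vol}_n(\phi(x_1)-\phi(x_0),\dots,\phi(x_n)-\phi(x_0))=1 . \] Then $\phi$ is an isometry if $\dim E\geq n+1$, and $\phi$ is an equiaffinity if $\dim E=n$.
   Context: The inner product spaces are not assumed to be complete or finite-dimensional. For vectors $v_1,\dots,v_n$ in a real inner product space, $\mathrm{Vol}_n(v_1,\dots,v_n)$ denotes the usual $n$-dimensional volume of the parallelepiped $\{\sum_{j=1}^n t_jv_j : t_j\in[0,1]\}$, i.e. $\mathrm{Vol}_n(v_1,\dots,v_n)=\sqrt{\det(\langle v_i,v_j\rangle)_{i,j=1}^n}$. An isometry is a map preserving the distances given by the inner product norms. An equiaffinity (equiaffine transformation) is an affine map $\phi\colon E\to F$ (linear map plus a constant) such that the matrix of the linear part of $\phi$, represented in some orthonormal bases of $E$ and of the range of $\phi$ (which is all of $F$ when $\phi$ is surjective), has determinant $\pm1$; in particular $E$ and this range have the same finite dimension. *)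

theory Defs
  imports "HOL-Analysis.Inner_Product" "Jordan_Normal_Form.Determinant"
begin

(* Finite families of vectors or points are functions on nat; only the entries at
   0, ..., n - 1 (vectors, basis elements) or 0, ..., n (points) are relevant. *)

definition Vol :: "nat \<Rightarrow> (nat \<Rightarrow> 'a::real_inner) \<Rightarrow> real" where
  "Vol n v = sqrt (Determinant.det (mat n n (\<lambda>(i, j). inner (v i) (v j))))"

definition isometry :: "('a::real_inner \<Rightarrow> 'b::real_inner) \<Rightarrow> bool" where
  "isometry \<phi> \<longleftrightarrow> (\<forall>x y. dist (\<phi> x) (\<phi> y) = dist x y)"

definition orthonormal_basis :: "nat \<Rightarrow> (nat \<Rightarrow> 'a::real_inner) \<Rightarrow> 'a set \<Rightarrow> bool" where
  "orthonormal_basis m e V \<longleftrightarrow>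
     (\<forall>i<m. \<forall>j<m. inner (e i) (e j) = (if i = j then 1 else 0)) \<and> span (e ` {..<m}) = V"

(* The range of an affine map need not contain 0, so its orthonormal bases are taken in
   its direction space range L.  As f is orthonormal, entry (i, j) below is the
   f i-coordinate of L (e j). *)

definition equiaffinity :: "('a::real_inner \<Rightarrow> 'b::real_inner) \<Rightarrow> bool" where
  "equiaffinity \<phi> \<longleftrightarrow>
     (\<exists>L c m e f. linear L \<and> (\<forall>x. \<phi> x = L x + c) \<and>
        orthonormal_basis m e UNIV \<and> orthonormal_basis m f (range L) \<and>
        \<bar>Determinant.det (mat m m (\<lambda>(i, j). inner (f i) (L (e j))))\<bar> = 1)"

end

theory Submission
  imports Defs
begin

text \<open>
  The proof recovers the affine structure from the families of volume one, and only then the metric.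
  All it uses about volumes is how they transform under linear substitutions (\<open>Vol_transform\<close>), in
  particular under scalings and shears, and that they are one on orthonormal families and zero on
  dependent ones. Let \<open>E\<close> be the domain of \<open>\<phi>\<close>.

  Two vectors \<open>a \<noteq> 0\<close> and \<open>b\<close> that have volume one with the same families of \<open>n - 1\<close> further
  vectors differ at most by sign: if they were independent, a family of volume one could contain \<open>a\<close>
  and a multiple of \<open>b\<close>, and replacing \<open>a\<close> by \<open>b\<close> would make it degenerate
  (\<open>equal_unit_volumes_imp_eq_or_minus\<close>). Applied at a base point \<open>q\<close>, this describes the reflection
  of a point in \<open>q\<close> by means of unit simplices alone. So \<open>\<phi>\<close> commutes with point reflections, and
  \<open>L x = \<phi> x - \<phi> 0\<close> is additive.

  Likewise \<open>d\<close> is a multiple of \<open>a \<noteq> 0\<close> exactly if adding \<open>d\<close> to the second vector of a family of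
  volume one that starts with \<open>a\<close> never changes the volume
  (\<open>in_span_singleton_iff_unit_volumes\<close>). Hence \<open>L\<close> maps lines through the origin to such lines, the
  factor \<open>s t\<close> in \<open>L (t x) = s t L x\<close> is the same for all \<open>x\<close>, and \<open>s\<close> is a ring endomorphism of the
  reals, that is, the identity. So \<open>L\<close> is linear (\<open>additive_line_preserving_imp_linear\<close>).

  If \<open>E\<close> has dimension \<open>n\<close>, the image of an orthonormal basis has volume one, and this volume is
  the absolute value of the determinant of \<open>L\<close>. If the dimension is larger, there are \<open>n + 1\<close>
  orthonormal vectors, and comparing the volumes of two families in their span shows that \<open>L\<close>
  preserves orthogonality (\<open>unit_volume_preserving_imp_orthogonality_preserving\<close>). Then \<open>L\<close> stretches
  all vectors of an orthonormal family by one common factor, whose \<open>n\<close>-th power is one.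
\<close>

section \<open>Gram determinants\<close>

abbreviation gram :: "nat \<Rightarrow> (nat \<Rightarrow> 'a::real_inner) \<Rightarrow> real mat" where
  "gram n v \<equiv> mat n n (\<lambda>(i, j). inner (v i) (v j))"

lemma Vol_eqI:
  assumes "\<And>i j. i < n \<Longrightarrow> j < n \<Longrightarrow> inner (v i) (v j) = inner (w i) (w j)"
  shows "Vol n v = Vol n w"
proof -
  have "gram n v = gram n w"
    using assms by (intro eq_matI) auto
  then show ?thesis
    by (simp add: Vol_def)
qed

lemma Vol_cong: "(\<And>i. i < n \<Longrightarrow> v i = w i) \<Longrightarrow> Vol n v = Vol n w"
  by (intro Vol_eqI) simp

text \<open>The source of all other transformation rules: the Gram matrix of the transformed family is
  \<open>P G P\<^sup>T\<close>, where \<open>G\<close> is the Gram matrix of \<open>v\<close>, and the real square root, extended to negative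
  arguments as an odd function, is multiplicative.\<close>

lemma Vol_transform:
  assumes P: "P \<in> carrier_mat n n"
  shows "Vol n (\<lambda>i. \<Sum>j<n. P $$ (i, j) *\<^sub>R v j) = \<bar>det P\<bar> * Vol n v"
proof -
  let ?w = "\<lambda>i. \<Sum>j<n. P $$ (i, j) *\<^sub>R v j"
  have G: "gram n v \<in> carrier_mat n n"
    by simp
  have "gram n ?w = P * gram n v * transpose_mat P"
  proof (rule eq_matI)
    fix i j
    assume "i < dim_row (P * gram n v * transpose_mat P)"
      and "j < dim_col (P * gram n v * transpose_mat P)"
    then have ij: "i < n" "j < n"
      using P by auto
    have "(P * gram n v * transpose_mat P) $$ (i, j)
        = (\<Sum>l<n. (\<Sum>k<n. P $$ (i, k) * inner (v k) (v l)) * P $$ (j, l))"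
      using P ij by (auto simp: scalar_prod_def atLeast0LessThan intro!: sum.cong)
    also have "\<dots> = inner (?w i) (?w j)"
      by (simp add: inner_sum_left inner_sum_right sum_distrib_left sum_distrib_right ac_simps)
    finally show "gram n ?w $$ (i, j) = (P * gram n v * transpose_mat P) $$ (i, j)"
      using ij by simp
  qed (use P in auto)
  then have "det (gram n ?w) = det P * det (gram n v) * det (transpose_mat P)"
    using P det_mult[OF mult_carrier_mat[OF P G], of "transpose_mat P"] det_mult[OF P G] by simp
  also have "\<dots> = (det P)\<^sup>2 * det (gram n v)"
    using P by (simp add: det_transpose[of _ n] power2_eq_square)
  finally show ?thesis
    by (simp add: Vol_def real_sqrt_mult)
qed

lemma Vol_scale:
  assumes k: "k < n"
  shows "Vol n (v(k := c *\<^sub>R v k)) = \<bar>c\<bar> * Vol n v"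
proof -
  have "Vol n (v(k := c *\<^sub>R v k)) = Vol n (\<lambda>i. \<Sum>j<n. multrow_mat n k c $$ (i, j) *\<^sub>R v j)"
  proof (rule Vol_cong)
    fix i assume i: "i < n"
    have "(\<Sum>j<n. multrow_mat n k c $$ (i, j) *\<^sub>R v j)
        = (\<Sum>j<n. if j = i then (if k = i then c else 1) *\<^sub>R v i else 0)"
      using i by (intro sum.cong) (auto simp: multrow_mat_def)
    then show "(v(k := c *\<^sub>R v k)) i = (\<Sum>j<n. multrow_mat n k c $$ (i, j) *\<^sub>R v j)"
      using i by auto
  qed
  then show ?thesis
    by (simp only: Vol_transform[OF multrow_mat_carrier] det_multrow_mat[OF k])
qed

lemma Vol_shear:
  assumes "k < n" "l < n" "k \<noteq> l"
  shows "Vol n (v(k := v k + c *\<^sub>R v l)) = Vol n v"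
proof -
  have "Vol n (v(k := v k + c *\<^sub>R v l)) = Vol n (\<lambda>i. \<Sum>j<n. addrow_mat n c k l $$ (i, j) *\<^sub>R v j)"
  proof (rule Vol_cong)
    fix i assume i: "i < n"
    have "(\<Sum>j<n. addrow_mat n c k l $$ (i, j) *\<^sub>R v j)
        = (\<Sum>j<n. (if j = i then v i else 0) + (if j = l then if k = i then c *\<^sub>R v l else 0 else 0))"
      using i assms by (intro sum.cong) (auto simp: addrow_mat_def)
    then show "(v(k := v k + c *\<^sub>R v l)) i = (\<Sum>j<n. addrow_mat n c k l $$ (i, j) *\<^sub>R v j)"
      using i assms by (auto simp: sum.distrib)
  qed
  then show ?thesis
    by (simp only: Vol_transform[OF addrow_mat_carrier] det_addrow_mat[OF \<open>k \<noteq> l\<close>] abs_one mult_1)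
qed

text \<open>The coefficients of a linear relation between the vectors form a kernel vector of their Gram
  matrix.\<close>

lemma Vol_eq_0_if_linear_relation:
  assumes c: "(\<Sum>i<n. c i *\<^sub>R v i) = 0" and k: "k < n" "c k \<noteq> 0"
  shows "Vol n v = 0"
proof -
  let ?c = "Matrix.vec n c"
  have "gram n v *\<^sub>v ?c = 0\<^sub>v n"
  proof (rule eq_vecI)
    fix i assume i: "i < dim_vec (0\<^sub>v n :: real Matrix.vec)"
    then have "(gram n v *\<^sub>v ?c) $ i = inner (v i) (\<Sum>j<n. c j *\<^sub>R v j)"
      by (auto simp: scalar_prod_def inner_sum_right atLeast0LessThan mult.commute intro!: sum.cong)
    then show "(gram n v *\<^sub>v ?c) $ i = 0\<^sub>v n $ i"
      using c i by simp
  qed simp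
  moreover have "?c \<noteq> 0\<^sub>v n"
    using k by (metis index_vec index_zero_vec(1))
  ultimately have "det (gram n v) = 0"
    by (subst det_0_iff_vec_prod_zero[of _ n]) (auto intro!: exI[of _ ?c])
  then show ?thesis
    by (simp add: Vol_def)
qed

lemma Vol_nonzero_imp_independent:
  assumes V: "Vol n v \<noteq> 0"
  shows "inj_on v {..<n}" and "independent (v ` {..<n})"
proof -
  show inj: "inj_on v {..<n}"
  proof (rule inj_onI, rule ccontr)
    fix i j assume ij: "i \<in> {..<n}" "j \<in> {..<n}" "v i = v j" "i \<noteq> j"
    have "(\<Sum>k<n. ((if k = i then 1 else 0) - (if k = j then 1 else 0)) *\<^sub>R v k) = 0"
      using ij by (simp add: scaleR_left_diff_distrib sum_subtractf if_distrib[of "\<lambda>c. c *\<^sub>R _"] cong: if_cong)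
    then show False
      using V ij by (subst (asm) Vol_eq_0_if_linear_relation[of _ _ _ i]) auto
  qed
  show "independent (v ` {..<n})"
  proof
    assume "dependent (v ` {..<n})"
    then obtain u k where u: "k < n" "u (v k) \<noteq> 0" "(\<Sum>x\<in>v ` {..<n}. u x *\<^sub>R x) = 0"
      by (auto simp: dependent_finite)
    then have "(\<Sum>i<n. u (v i) *\<^sub>R v i) = 0"
      by (simp add: sum.reindex[OF inj])
    then show False
      using V u Vol_eq_0_if_linear_relation[of "\<lambda>i. u (v i)" v n k] by simp
  qed
qed

section \<open>Orthonormal systems\<close>

definition orthonormal :: "nat \<Rightarrow> (nat \<Rightarrow> 'a::real_inner) \<Rightarrow> bool" where
  "orthonormal m e \<longleftrightarrow> (\<forall>i<m. \<forall>j<m. inner (e i) (e j) = (if i = j then 1 else 0))"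

lemma orthonormal_basis_iff:
  "orthonormal_basis m e V \<longleftrightarrow> orthonormal m e \<and> span (e ` {..<m}) = V"
  by (simp add: orthonormal_basis_def orthonormal_def)

lemma Vol_orthonormal:
  assumes "orthonormal n e"
  shows "Vol n e = 1"
proof -
  have "gram n e = 1\<^sub>m n"
    using assms by (intro eq_matI) (auto simp: orthonormal_def)
  then show ?thesis
    by (simp add: Vol_def)
qed

lemma orthonormal_independent:
  assumes "orthonormal n e"
  shows "inj_on e {..<n}" and "independent (e ` {..<n})" and "card (e ` {..<n}) = n"
  using Vol_nonzero_imp_independent[of n e] Vol_orthonormal[OF assms]
  by (auto simp: card_image)

lemma inner_eq_0_on_span:
  assumes "x \<in> span S" and "\<And>s. s \<in> S \<Longrightarrow> inner y s = 0"
  shows "inner y x = 0"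
  using assms(1)
  by (induction rule: span_induct_alt) (use assms(2) in \<open>auto simp: inner_add_right\<close>)

text \<open>Orthogonal projection onto a finite-dimensional span exists in every inner product space. The
  induction is a Gram--Schmidt step: the new vector \<open>s\<close> is first replaced by its component \<open>s - q\<close>
  orthogonal to the old span. If that component is zero, so is the coefficient, by division by zero.\<close>

lemma orthogonal_projection_exists:
  fixes x :: "'a::real_inner"
  assumes "finite S"
  shows "\<exists>p\<in>span S. \<forall>s\<in>S. inner (x - p) s = 0"
  using assms
proof (induction S arbitrary: x)
  case empty
  then show ?case by (auto intro: span_zero)
next
  case (insert s S)
  obtain p where p: "p \<in> span S" "\<forall>t\<in>S. inner (x - p) t = 0"
    using insert.IH by blast
  obtain q where q: "q \<in> span S" "\<forall>t\<in>S. inner (s - q) t = 0"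
    using insert.IH by blast
  let ?r = "s - q"
  let ?p = "p + (inner (x - p) ?r / inner ?r ?r) *\<^sub>R ?r"
  have sub: "span S \<subseteq> span (insert s S)"
    by (rule span_mono) auto
  have "?p \<in> span (insert s S)"
    using p(1) q(1) sub
    by (intro span_add span_scale span_diff) (auto intro: span_base)
  moreover have orth: "inner (x - ?p) t = 0" if "t \<in> S" for t
    using p(2) q(2) that by (simp add: inner_diff_left inner_add_left)
  moreover have "inner (x - ?p) s = 0"
  proof -
    have "inner (x - ?p) q = 0"
      using q(1) orth by (rule inner_eq_0_on_span)
    moreover have "inner (x - ?p) ?r = 0"
    proof -
      have "inner (x - (p + (inner (x - p) r / inner r r) *\<^sub>R r)) r = 0" for r
        by (cases "r = 0") (simp_all add: inner_diff_left inner_add_left)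
      then show ?thesis .
    qed
    ultimately show ?thesis
      by (simp add: inner_diff_right)
  qed
  ultimately show ?case by blast
qed

text \<open>An independent set with more than \<open>k\<close> elements cannot lie in the span of \<open>k\<close> vectors; one of its
  elements outside that span is projected away from it and normalised.\<close>

lemma orthonormal_extension_step:
  fixes e :: "nat \<Rightarrow> 'a::real_inner"
  assumes e: "orthonormal k e" "\<And>i. i < k \<Longrightarrow> e i \<in> V"
    and V: "subspace V" and B: "B \<subseteq> V" "independent B" "k < card B"
  shows "\<exists>u\<in>V. orthonormal (Suc k) (e(k := u))"
proof -
  let ?S = "e ` {..<k}"
  have "\<not> B \<subseteq> span ?S"
  proof
    assume "B \<subseteq> span ?S"
    then have "card B \<le> card ?S"
      using independent_span_bound[of ?S B] B(2) by simp
    also have "\<dots> \<le> k"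
      using card_image_le[of "{..<k}" e] by simp
    finally show False
      using B(3) by simp
  qed
  then obtain x where x: "x \<in> B" "x \<notin> span ?S" by blast
  obtain p where p: "p \<in> span ?S" "\<forall>s\<in>?S. inner (x - p) s = 0"
    using orthogonal_projection_exists[of ?S x] by auto
  have ne: "x - p \<noteq> 0"
    using x p(1) by auto
  have "span ?S \<subseteq> V"
    using e(2) V by (intro span_minimal) auto
  then have "x - p \<in> V"
    using x(1) B(1) p(1) V by (auto intro: subspace_diff)
  then have "sgn (x - p) \<in> V"
    using V by (simp add: sgn_div_norm subspace_scale)
  moreover have "inner (sgn (x - p)) (e i) = 0" if "i < k" for i
    using p(2) that by (simp add: sgn_div_norm)
  moreover have "inner (sgn (x - p)) (sgn (x - p)) = 1"
    using ne by (simp add: norm_sgn flip: power2_norm_eq_inner)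
  ultimately show ?thesis
    using e(1) by (intro bexI[of _ "sgn (x - p)"])
      (auto simp: orthonormal_def less_Suc_eq inner_commute)
qed

lemma orthonormal_extension:
  fixes e :: "nat \<Rightarrow> 'a::real_inner"
  assumes e: "orthonormal k e" "\<And>i. i < k \<Longrightarrow> e i \<in> V"
    and V: "subspace V" and B: "B \<subseteq> V" "independent B"
    and m: "k \<le> m" "m \<le> card B"
  shows "\<exists>f. orthonormal m f \<and> (\<forall>i<k. f i = e i) \<and> (\<forall>i<m. f i \<in> V)"
  using m
proof (induction m rule: dec_induct)
  case base
  then show ?case using e by blast
next
  case (step l)
  then obtain f where f: "orthonormal l f" "\<forall>i<k. f i = e i" "\<forall>i<l. f i \<in> V"
    by auto
  obtain u where "u \<in> V" "orthonormal (Suc l) (f(l := u))"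
    using orthonormal_extension_step[of l f V B] f V B step.prems by auto
  moreover have "\<forall>i<k. (f(l := u)) i = e i"
    using f(2) step.hyps by simp
  ultimately show ?case
    using f(3) by (intro exI[of _ "f(l := u)"]) (simp add: less_Suc_eq del: fun_upd_apply, simp)
qed

text \<open>An orthonormal system in \<open>span B\<close> with \<open>card B\<close> elements is maximal for reasons of cardinality, and
  hence spans.\<close>

lemma orthonormal_basis_of_span:
  fixes B :: "'a::real_inner set"
  assumes B: "finite B" "independent B"
  shows "\<exists>f. orthonormal_basis (card B) f (span B)"
proof -
  obtain f where f: "orthonormal (card B) f" "\<forall>i<card B. f i \<in> span B"
    using orthonormal_extension[of 0 "\<lambda>_. 0" "span B" B "card B"] B
    by (auto simp: orthonormal_def span_superset)
  let ?S = "f ` {..<card B}"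
  have "span B \<subseteq> span ?S"
  proof
    fix x assume x: "x \<in> span B"
    show "x \<in> span ?S"
    proof (rule ccontr)
      assume nx: "x \<notin> span ?S"
      then have "independent (insert x ?S)"
        using orthonormal_independent(2)[OF f(1)] by (simp add: independent_insert)
      moreover have "insert x ?S \<subseteq> span B"
        using x f(2) by auto
      ultimately have "card (insert x ?S) \<le> card B"
        using independent_span_bound[OF B(1)] by simp
      moreover have "x \<notin> ?S"
        using nx span_base[of x ?S] by auto
      ultimately show False
        using orthonormal_independent(3)[OF f(1)] by simp
    qed
  qed
  moreover have "span ?S \<subseteq> span B"
    using f(2) by (intro span_minimal) auto
  ultimately show ?thesis
    using f(1) by (auto simp: orthonormal_basis_iff)
qed

lemma orthonormal_expansion:
  assumes f: "orthonormal m f" and x: "x \<in> span (f ` {..<m})"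
  shows "x = (\<Sum>i<m. inner (f i) x *\<^sub>R f i)"
proof -
  let ?y = "x - (\<Sum>i<m. inner (f i) x *\<^sub>R f i)"
  have "inner ?y (f j) = 0" if "j < m" for j
  proof -
    have "(\<Sum>i<m. inner (f i) x * inner (f i) (f j)) = (\<Sum>i<m. if i = j then inner (f j) x else 0)"
      using f that by (intro sum.cong) (auto simp: orthonormal_def)
    then show ?thesis
      using that by (simp add: inner_diff_left inner_sum_left inner_commute[of x "f j"])
  qed
  moreover have "?y \<in> span (f ` {..<m})"
    using x by (intro span_diff span_sum span_scale) (auto intro: span_base)
  ultimately have "inner ?y ?y = 0"
    by (intro inner_eq_0_on_span[of ?y "f ` {..<m}"]) auto
  then show ?thesis
    by (simp only: inner_eq_zero_iff right_minus_eq)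
qed

section \<open>Families of volume one\<close>

text \<open>The witnesses for all later characterisations. Some multiple of \<open>b\<close> is needed because for
  \<open>n = 2\<close> the vectors \<open>a\<close> and \<open>b\<close> alone already determine the volume.\<close>

lemma unit_volume_family_exists:
  fixes a b :: "'a::real_inner" and B :: "'a set"
  assumes n: "n \<ge> 2" and B: "independent B" "card B = n"
    and a: "a \<noteq> 0" and b: "b \<notin> span {a}"
  shows "\<exists>c v. c > 0 \<and> v 0 = a \<and> v 1 = c *\<^sub>R b \<and> Vol n v = 1"
proof -
  obtain p where p: "p \<in> span {a}" "inner (b - p) a = 0"
    using orthogonal_projection_exists[of "{a}" b] by auto
  then obtain t where t: "p = t *\<^sub>R a"
    by (auto simp: span_singleton)
  have ne: "b - p \<noteq> 0"
    using b p(1) by auto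
  have o2: "orthonormal 2 ((\<lambda>_. sgn a)(1 := sgn (b - p)))"
  proof -
    have unit: "inner (sgn x) (sgn x) = 1" if "x \<noteq> 0" for x :: 'a
      using that by (simp add: norm_sgn flip: power2_norm_eq_inner)
    have "inner (sgn (b - p)) (sgn a) = 0"
      using p(2) by (simp add: sgn_div_norm)
    then show ?thesis
      using unit[OF a] unit[OF ne]
      by (simp add: orthonormal_def numeral_2_eq_2 less_Suc_eq all_conj_distrib inner_commute)
  qed
  obtain e where e: "orthonormal n e" "e 0 = sgn a" "e 1 = sgn (b - p)"
  proof -
    obtain e where "orthonormal n e" "\<forall>i<2. e i = ((\<lambda>_. sgn a)(1 := sgn (b - p))) i"
      using orthonormal_extension[OF o2, of UNIV B n] B n by auto
    then show thesis
      using that[of e] by simp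
  qed
  have [simp]: "norm x *\<^sub>R sgn x = x" for x :: 'a
    by (cases "x = 0") (simp_all add: sgn_div_norm)
  \<comment> \<open>The orthonormal family \<open>e\<close> is deformed so that it starts with \<open>a\<close> and \<open>b\<close>: two scalings
    produce \<open>a\<close> and \<open>b - p\<close>, and a shear adds the component \<open>p\<close> of \<open>b\<close> along \<open>a\<close>.\<close>
  let ?f = "e(0 := norm a *\<^sub>R e 0)"
  let ?g = "?f(1 := norm (b - p) *\<^sub>R ?f 1)"
  define h where "h = ?g(1 := ?g 1 + t *\<^sub>R ?g 0)"
  have h: "h 0 = a" "h 1 = b"
    using e(2,3) t by (simp_all add: h_def)
  have "Vol n h = Vol n ?g"
    unfolding h_def using n by (intro Vol_shear) auto
  also have "\<dots> = norm (b - p) * Vol n ?f"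
    using n by (subst Vol_scale) auto
  also have "\<dots> = norm (b - p) * norm a"
    using n Vol_orthonormal[OF e(1)] by (subst Vol_scale) auto
  finally have V: "Vol n h > 0"
    using a ne by simp
  define c where "c = inverse (Vol n h)"
  have "Vol n (h(1 := c *\<^sub>R h 1)) = 1"
    using n V by (subst Vol_scale) (auto simp: c_def)
  moreover have "c > 0"
    using V by (simp add: c_def)
  ultimately show ?thesis
    using h by (intro exI[of _ c] exI[of _ "h(1 := c *\<^sub>R h 1)"]) simp
qed

lemma ex_not_in_span_singleton:
  fixes a :: "'a::real_vector" and B :: "'a set"
  assumes "independent B" "card B \<ge> 2"
  shows "\<exists>b. b \<notin> span {a}"
proof (rule ccontr)
  assume "\<not> ?thesis"
  then have "B \<subseteq> span {a}" by blast
  then have "card B \<le> card {a}"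
    using independent_span_bound[of "{a}" B] assms(1) by simp
  then show False
    using assms(2) by simp
qed

text \<open>Collinearity with \<open>a\<close> in terms of unit volumes. If \<open>d\<close> is not a multiple of \<open>a\<close>, there is a family of
  volume one whose second vector is \<open>c d\<close> with \<open>c > 0\<close>; adding \<open>d\<close> multiplies its volume by
  \<open>(c + 1) / c\<close>, which is not one.\<close>

lemma in_span_singleton_iff_unit_volumes:
  fixes a d :: "'a::real_inner" and B :: "'a set"
  assumes n: "n \<ge> 2" and B: "independent B" "card B = n" and a: "a \<noteq> 0"
  shows "d \<in> span {a} \<longleftrightarrow>
    (\<forall>v. v 0 = a \<longrightarrow> Vol n v = 1 \<longrightarrow> Vol n (v(1 := v 1 + d)) = 1)"
proof
  assume "d \<in> span {a}"
  then obtain t where "d = t *\<^sub>R a"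
    by (auto simp: span_singleton)
  then have "Vol n (v(1 := v 1 + d)) = Vol n v" if "v 0 = a" for v
    using n that Vol_shear[of 1 n 0 v t] by simp
  then show "\<forall>v. v 0 = a \<longrightarrow> Vol n v = 1 \<longrightarrow> Vol n (v(1 := v 1 + d)) = 1"
    by simp
next
  assume shift: "\<forall>v. v 0 = a \<longrightarrow> Vol n v = 1 \<longrightarrow> Vol n (v(1 := v 1 + d)) = 1"
  show "d \<in> span {a}"
  proof (rule ccontr)
    assume "d \<notin> span {a}"
    then obtain c v where v: "c > 0" "v 0 = a" "v 1 = c *\<^sub>R d" "Vol n v = 1"
      using unit_volume_family_exists[OF n B a] by blast
    then have "v 1 + d = ((c + 1) / c) *\<^sub>R v 1"
      by (simp add: scaleR_add_left)
    then have "Vol n (v(1 := v 1 + d)) = \<bar>(c + 1) / c\<bar> * Vol n v"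
      using n Vol_scale[of 1 n v "(c + 1) / c"] by simp
    moreover have "Vol n (v(1 := v 1 + d)) = 1"
      using shift v by blast
    ultimately show False
      using v by (simp add: field_simps)
  qed
qed

text \<open>If \<open>b\<close> were not a multiple of \<open>a\<close>, then in a family of volume one that contains \<open>a\<close> and \<open>c b\<close>
  the vector \<open>a\<close> could be replaced by \<open>b\<close>, which makes the family dependent. So \<open>b = t a\<close>, and one
  family of volume one starting with \<open>a\<close> shows that \<open>\<bar>t\<bar> = 1\<close>.\<close>

lemma equal_unit_volumes_imp_eq_or_minus:
  fixes a b :: "'a::real_inner" and B :: "'a set"
  assumes n: "n \<ge> 2" and B: "independent B" "card B = n" and a: "a \<noteq> 0"
    and ab: "\<And>v. Vol n (v(0 := a)) = 1 \<longleftrightarrow> Vol n (v(0 := b)) = 1"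
  shows "b = a \<or> b = - a"
proof -
  have upd: "v(0 := x) = v" if "v 0 = x" for v :: "nat \<Rightarrow> 'a" and x
    using that by auto
  have "b \<in> span {a}"
  proof (rule ccontr)
    assume "b \<notin> span {a}"
    then obtain c v where v: "v 0 = a" "v 1 = c *\<^sub>R b" "Vol n v = 1"
      using unit_volume_family_exists[OF n B a] by blast
    then have "Vol n (v(0 := b)) = 1"
      using ab upd by metis
    \<comment> \<open>Subtracting \<open>c\<close> times the first vector turns the second one into \<open>0\<close>.\<close>
    have "Vol n (v(0 := b, 1 := v 1 + (- c) *\<^sub>R b)) = 1"
      using n \<open>Vol n (v(0 := b)) = 1\<close> Vol_shear[of 1 n 0 "v(0 := b)" "- c"] by simp
    moreover have "Vol n (v(0 := b, 1 := 0)) = 0"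
      using n Vol_scale[of 1 n "v(0 := b)" 0] by simp
    ultimately show False
      using v(2) by simp
  qed
  then obtain t where t: "b = t *\<^sub>R a"
    by (auto simp: span_singleton)
  obtain y where "y \<notin> span {a}"
    using ex_not_in_span_singleton[of B a] B n by blast
  then obtain c v where v: "v 0 = a" "Vol n v = 1"
    using unit_volume_family_exists[OF n B a] by blast
  have "Vol n (v(0 := b)) = 1"
    using ab v upd by metis
  then have "\<bar>t\<bar> = 1"
    using n Vol_scale[of 0 n v t] v t by simp
  then show ?thesis
    using t by (auto simp: abs_if split: if_splits)
qed

section \<open>Additive maps that preserve lines through the origin\<close>

text \<open>Squares are mapped to squares, so a ring endomorphism of the reals is monotone; as it fixes the
  rationals, it fixes everything.\<close>

lemma real_ring_endomorphism_eq_id: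
  fixes s :: "real \<Rightarrow> real"
  assumes add: "\<And>x y. s (x + y) = s x + s y" and mult: "\<And>x y. s (x * y) = s x * s y"
    and one: "s 1 = 1"
  shows "s t = t"
proof -
  have zero: "s 0 = 0"
    using add[of 0 0] by simp
  have minus: "s (- x) = - s x" for x
    using add[of x "- x"] zero by simp
  have nat: "s (of_nat k) = of_nat k" for k
    by (induction k) (simp_all add: zero add one)
  have int: "s (of_int i) = of_int i" for i
    by (cases i rule: int_cases2) (simp_all add: nat minus)
  have rat: "s q = q" if q_rat: "q \<in> \<rat>" for q
  proof -
    obtain i and k :: nat where q: "q = of_int i / of_nat k" "k \<noteq> 0"
      using q_rat unfolding Rats_eq_int_div_nat by blast
    then have "s q * of_nat k = of_int i"
      using mult[of q "of_nat k"] int[of i] nat[of k] by simp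
    then have "s q * of_nat k = q * of_nat k"
      using q by simp
    then show ?thesis
      using q(2) by simp
  qed
  have mono: "s x \<le> s y" if "x \<le> y" for x y
  proof -
    have "s y = s x + s (sqrt (y - x)) * s (sqrt (y - x))"
      using that by (simp flip: add mult)
    then show ?thesis by simp
  qed
  show ?thesis
  proof (rule ccontr)
    assume "s t \<noteq> t"
    then consider "s t < t" | "t < s t" by linarith
    then show False
    proof cases
      case 1
      then obtain q where q: "q \<in> \<rat>" "s t < q" "q < t"
        using Rats_dense_in_real by blast
      then show False
        using mono[of q t] rat[OF q(1)] by simp
    next
      case 2
      then obtain q where q: "q \<in> \<rat>" "t < q" "q < s t"
        using Rats_dense_in_real by blast
      then show False
        using mono[of t q] rat[OF q(1)] by simp
    qed
  qed
qed

text \<open>The algebraic part of the fundamental theorem of affine geometry. On each line through the origin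
  the map multiplies by a function of the scalar. For independent \<open>a\<close> and \<open>b\<close> these functions agree
  with the one of \<open>a + b\<close>, by comparing coefficients in \<open>L (t (a + b)) = L (t a) + L (t b)\<close>; for
  dependent vectors a third direction mediates. The common function is additive and multiplicative.\<close>

lemma additive_line_preserving_imp_linear:
  fixes L :: "'a::real_vector \<Rightarrow> 'b::real_vector"
  assumes add: "\<And>x y. L (x + y) = L x + L y"
    and ker: "\<And>x. L x = 0 \<Longrightarrow> x = 0"
    and line: "\<And>a d. a \<noteq> 0 \<Longrightarrow> d \<in> span {a} \<longleftrightarrow> L d \<in> span {L a}"
    and two: "\<And>a. \<exists>b :: 'a. b \<notin> span {a}"
  shows "linear L"
proof -
  have "\<forall>x t. \<exists>r. x \<noteq> 0 \<longrightarrow> L (t *\<^sub>R x) = r *\<^sub>R L x"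
  proof (intro allI)
    fix x :: 'a and t :: real
    have "t *\<^sub>R x \<in> span {x}"
      by (simp add: span_base span_scale)
    then show "\<exists>r. x \<noteq> 0 \<longrightarrow> L (t *\<^sub>R x) = r *\<^sub>R L x"
      using line[of x "t *\<^sub>R x"] by (auto simp: span_singleton)
  qed
  then obtain S where S: "\<And>x t. x \<noteq> 0 \<Longrightarrow> L (t *\<^sub>R x) = S x t *\<^sub>R L x"
    by metis
  have eq: "S a t = S b t" if a: "a \<noteq> 0" and b: "b \<notin> span {a}" for a b t
  proof -
    have b0: "b \<noteq> 0"
      using b by (auto simp: span_zero)
    have ab0: "a + b \<noteq> 0"
    proof
      assume "a + b = 0"
      then have "b = (- 1) *\<^sub>R a"
        by (simp add: eq_neg_iff_add_eq_0 add.commute)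
      then show False
        using b by (metis span_base span_scale singletonI)
    qed
    have "S (a + b) t *\<^sub>R (L a + L b) = S a t *\<^sub>R L a + S b t *\<^sub>R L b"
      using S[OF ab0, of t] S[OF a, of t] S[OF b0, of t] by (simp add: add scaleR_add_right)
    then have lin: "(S (a + b) t - S b t) *\<^sub>R L b = (S a t - S (a + b) t) *\<^sub>R L a"
      by (simp add: algebra_simps)
    have ind: "L b \<notin> span {L a}"
      using line[OF a] b by simp
    have *: "S (a + b) t = S b t"
    proof (rule ccontr)
      assume ne: "S (a + b) t \<noteq> S b t"
      let ?r = "S (a + b) t - S b t"
      have "L b = inverse ?r *\<^sub>R (?r *\<^sub>R L b)"
        using ne by simp
      also have "\<dots> = (inverse ?r * (S a t - S (a + b) t)) *\<^sub>R L a"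
        by (simp only: lin scaleR_scaleR)
      finally show False
        using ind by (metis span_base span_scale singletonI)
    qed
    moreover have "S a t = S (a + b) t"
      using lin * ker a by auto
    ultimately show ?thesis by simp
  qed
  obtain a :: 'a where a: "a \<noteq> 0"
    using two[of 0] span_zero by metis
  define s where "s = S a"
  have L: "L (t *\<^sub>R x) = s t *\<^sub>R L x" for t x
  proof (cases "x = 0")
    case True
    then show ?thesis
      using add[of 0 0] by simp
  next
    case False
    have "S x t = s t"
    proof (cases "x \<in> span {a}")
      case True
      then obtain r where r: "x = r *\<^sub>R a"
        by (auto simp: span_singleton)
      obtain b where b: "b \<notin> span {a}"
        using two by blast
      moreover have "span {x} \<subseteq> span {a}"
        using True by (intro span_minimal) auto
      ultimately have "b \<notin> span {x}" by blast
      then show ?thesis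
        using eq[OF a b] eq[OF False] by (simp add: s_def)
    next
      case notin: False
      then show ?thesis
        using eq[OF a notin] by (simp add: s_def)
    qed
    then show ?thesis
      using S[OF False] by simp
  qed
  have La: "L a \<noteq> 0"
    using ker a by blast
  have cancel: "r = r'" if "r *\<^sub>R L a = r' *\<^sub>R L a" for r r' :: real
    using that La by simp
  have "s (x + y) = s x + s y" for x y
    using L[of "x + y" a] L[of x a] L[of y a] by (intro cancel) (simp add: scaleR_add_left add)
  moreover have "s (x * y) = s x * s y" for x y
    using L[of "x * y" a] L[of x "y *\<^sub>R a"] L[of y a] by (intro cancel) simp
  moreover have "s 1 = 1"
    using L[of 1 a] by (intro cancel) simp
  ultimately have "s t = t" for t
    by (rule real_ring_endomorphism_eq_id)
  then show ?thesis
    using L by (intro linearI) (simp_all add: add)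
qed

section \<open>Maps that preserve unit volumes in both directions\<close>

text \<open>The hypotheses common to both parts of the theorem. From here on everything rests on carrying the
  characterisations by unit volumes from the domain to the range; surjectivity is what allows
  quantifiers over families of vectors in the range to be pulled back.\<close>

locale unit_volume_map =
  fixes \<phi> :: "'a::real_inner \<Rightarrow> 'b::real_inner" and n :: nat
  assumes n_ge_2: "n \<ge> 2"
    and surj: "surj \<phi>"
    and dim_ge: "\<exists>B :: 'a set. independent B \<and> card B = n"
    and unit_simplex_iff: "\<And>x :: nat \<Rightarrow> 'a.
      Vol n (\<lambda>i. x (Suc i) - x 0) = 1 \<longleftrightarrow> Vol n (\<lambda>i. \<phi> (x (Suc i)) - \<phi> (x 0)) = 1"
begin

lemma unit_volume_iff: "Vol n v = 1 \<longleftrightarrow> Vol n (\<lambda>i. \<phi> (p + v i) - \<phi> p) = 1"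
  using unit_simplex_iff[of "case_nat p (\<lambda>i. p + v i)"] by simp

lemma family_lift:
  obtains v where "\<And>i. \<phi> (p + v i) - \<phi> p = w i"
proof
  show "\<phi> (p + (inv_into UNIV \<phi> (w i + \<phi> p) - p)) - \<phi> p = w i" for i
    by (simp add: surj_f_inv_f[OF surj])
qed

lemma unit_volume_family:
  assumes "a \<noteq> 0"
  obtains v where "v 0 = (a :: 'a)" "Vol n v = 1"
proof -
  obtain B :: "'a set" where B: "independent B" "card B = n"
    using dim_ge by blast
  then obtain b where "b \<notin> span {a}"
    using ex_not_in_span_singleton[of B a] n_ge_2 by auto
  then show thesis
    using unit_volume_family_exists[OF n_ge_2 B assms] that by blast
qed

text \<open>The characterisations have to be applied in the range as well, which needs enough room there: the
  image of a family of volume one supplies \<open>n\<close> independent vectors.\<close>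

lemma range_dim_ge: "\<exists>C :: 'b set. independent C \<and> card C = n"
proof -
  obtain B :: "'a set" where B: "independent B" "card B = n"
    using dim_ge by blast
  then obtain a :: 'a where "a \<notin> span {0}"
    using ex_not_in_span_singleton[of B 0] n_ge_2 by auto
  then have "a \<noteq> 0"
    using span_zero by metis
  then obtain v :: "nat \<Rightarrow> 'a" where "Vol n v = 1"
    by (rule unit_volume_family)
  then have "Vol n (\<lambda>i. \<phi> (0 + v i) - \<phi> 0) \<noteq> 0"
    using unit_volume_iff[of v 0] by simp
  from Vol_nonzero_imp_independent[OF this] show ?thesis
    using card_image by fastforce
qed

text \<open>Distinct points are vertices of a common unit simplex, but the image of that simplex
  would have a repeated vertex.\<close>

lemma injective:
  assumes "\<phi> x = \<phi> y"
  shows "x = y"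
proof (rule ccontr)
  assume "x \<noteq> y"
  then obtain v where v: "v 0 = y - x" "Vol n v = 1"
    using unit_volume_family[of "y - x"] by auto
  let ?w = "\<lambda>i. \<phi> (x + v i) - \<phi> x"
  have "?w 0 = 0"
    using v(1) assms by simp
  then have "Vol n ?w = 0"
    using n_ge_2 by (intro Vol_eq_0_if_linear_relation[of "\<lambda>i. if i = 0 then 1 else 0" _ _ 0])
      (auto intro!: sum.neutral)
  then show False
    using v(2) unit_volume_iff[of v x] by simp
qed

text \<open>A point \<open>p \<noteq> q\<close> and its reflection in \<open>q\<close> form unit simplices with \<open>q\<close> and exactly the same
  \<open>n - 1\<close> further points. The images inherit this property, so that seen from \<open>\<phi> q\<close> they are equal or
  opposite, and injectivity excludes the former.\<close>

lemma point_reflection: "\<phi> (q + (q - p)) - \<phi> q = - (\<phi> p - \<phi> q)"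
proof (cases "p = q")
  case False
  let ?a = "\<phi> p - \<phi> q" and ?b = "\<phi> (q + (q - p)) - \<phi> q"
  obtain C :: "'b set" where C: "independent C" "card C = n"
    using range_dim_ge by blast
  have "Vol n (w(0 := ?a)) = 1 \<longleftrightarrow> Vol n (w(0 := ?b)) = 1" for w
  proof -
    obtain v where v: "\<And>i. \<phi> (q + v i) - \<phi> q = w i"
      using family_lift by blast
    have "(\<lambda>i. \<phi> (q + (v(0 := p - q)) i) - \<phi> q) = w(0 := ?a)"
      using v by auto
    then have "Vol n (w(0 := ?a)) = 1 \<longleftrightarrow> Vol n (v(0 := p - q)) = 1"
      using unit_volume_iff[of "v(0 := p - q)" q] by simp
    also have "\<dots> \<longleftrightarrow> Vol n (v(0 := q - p)) = 1"
      using n_ge_2 Vol_scale[of 0 n "v(0 := p - q)" "- 1"] by simp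
    also have "(\<lambda>i. \<phi> (q + (v(0 := q - p)) i) - \<phi> q) = w(0 := ?b)"
      using v by auto
    then have "Vol n (v(0 := q - p)) = 1 \<longleftrightarrow> Vol n (w(0 := ?b)) = 1"
      using unit_volume_iff[of "v(0 := q - p)" q] by simp
    finally show ?thesis .
  qed
  moreover have "?a \<noteq> 0"
    using False injective by auto
  ultimately have "?b = ?a \<or> ?b = - ?a"
    using equal_unit_volumes_imp_eq_or_minus[OF n_ge_2 C] by blast
  moreover have "?b \<noteq> ?a"
  proof
    assume "?b = ?a"
    then have "q + (q - p) = p"
      by (intro injective) simp
    then have "2 *\<^sub>R (q - p) = 0"
      by (simp add: scaleR_2 algebra_simps)
    then show False
      using False by simp
  qed
  ultimately show ?thesis by blast
qed simp

text \<open>The linear part of \<open>\<phi>\<close>, once \<open>\<phi>\<close> is known to be affine.\<close>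

definition L :: "'a \<Rightarrow> 'b" where
  "L x = \<phi> x - \<phi> 0"

lemma unit_volume_L_iff: "Vol n v = 1 \<longleftrightarrow> Vol n (\<lambda>i. L (v i)) = 1"
  using unit_volume_iff[of v 0] by (simp add: L_def)

lemma L_add: "L (x + y) = L x + L y"
proof -
  have reflect: "L (2 *\<^sub>R q - p) = 2 *\<^sub>R L q - L p" for p q
  proof -
    have "L (2 *\<^sub>R q - p) = (\<phi> (q + (q - p)) - \<phi> q) + \<phi> q - \<phi> 0"
      by (simp add: L_def scaleR_2 add_diff_eq)
    also have "\<dots> = - (\<phi> p - \<phi> q) + \<phi> q - \<phi> 0"
      by (simp only: point_reflection)
    finally show ?thesis
      by (simp add: L_def scaleR_2)
  qed
  have zero: "L 0 = 0"
    by (simp add: L_def)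
  have double: "L (2 *\<^sub>R x) = 2 *\<^sub>R L x" for x
    using reflect[of x 0] zero by simp
  have minus: "L (- x) = - L x" for x
    using reflect[of 0 x] zero by simp
  have "2 *\<^sub>R L (x + y) = L (2 *\<^sub>R x - 2 *\<^sub>R (- y))"
    by (simp add: double[symmetric] scaleR_add_right)
  also have "\<dots> = 2 *\<^sub>R (L x + L y)"
    by (simp only: reflect double minus) (simp add: scaleR_add_right)
  finally show ?thesis by simp
qed

lemma L_linear: "linear L"
proof (rule additive_line_preserving_imp_linear)
  show ker: "x = 0" if "L x = 0" for x
    using that by (intro injective) (simp add: L_def)
  obtain B :: "'a set" where B: "independent B" "card B = n"
    using dim_ge by blast
  show "\<exists>b. b \<notin> span {a}" for a :: 'a
    using ex_not_in_span_singleton[of B a] B n_ge_2 by simp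
  obtain C :: "'b set" where C: "independent C" "card C = n"
    using range_dim_ge by blast
  show "d \<in> span {a} \<longleftrightarrow> L d \<in> span {L a}" if a: "a \<noteq> 0" for a d
  proof -
    let ?P = "\<lambda>v. v 0 = a \<longrightarrow> Vol n v = 1 \<longrightarrow> Vol n (v(1 := v 1 + d)) = 1"
    let ?Q = "\<lambda>w. w 0 = L a \<longrightarrow> Vol n w = 1 \<longrightarrow> Vol n (w(1 := w 1 + L d)) = 1"
    have PQ: "?P v \<longleftrightarrow> ?Q (\<lambda>i. L (v i))" for v
    proof -
      have "(\<lambda>i. L ((v(1 := v 1 + d)) i)) = (\<lambda>i. L (v i))(1 := L (v 1) + L d)"
        by (auto simp: L_add)
      moreover have "L (v 0) = L a \<longleftrightarrow> v 0 = a"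
        using injective by (auto simp: L_def)
      ultimately show ?thesis
        using unit_volume_L_iff[of v] unit_volume_L_iff[of "v(1 := v 1 + d)"] by simp
    qed
    have "(\<forall>v. ?P v) \<longleftrightarrow> (\<forall>w. ?Q w)"
    proof
      assume P: "\<forall>v. ?P v"
      show "\<forall>w. ?Q w"
      proof
        fix w :: "nat \<Rightarrow> 'b"
        obtain v where "\<And>i. \<phi> (0 + v i) - \<phi> 0 = w i"
          using family_lift by blast
        then have "w = (\<lambda>i. L (v i))"
          by (auto simp: L_def)
        then show "?Q w"
          using PQ[of v] spec[OF P, of v] by simp
      qed
    next
      assume Q: "\<forall>w. ?Q w"
      show "\<forall>v. ?P v"
      proof
        fix v
        show "?P v"
          using PQ[of v] spec[OF Q, of "\<lambda>i. L (v i)"] by (rule iffD2)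
      qed
    qed
    moreover have "L a \<noteq> 0"
      using ker a by blast
    ultimately show ?thesis
      using in_span_singleton_iff_unit_volumes[OF n_ge_2 B a]
        in_span_singleton_iff_unit_volumes[OF n_ge_2 C] by simp
  qed
qed (rule L_add)

end

section \<open>Linear maps that preserve unit volumes\<close>

text \<open>Let \<open>H\<close> be the span of \<open>n\<close> orthonormal vectors that are orthogonal to \<open>a\<close>, the first of them being
  \<open>b\<close>. There is \<open>h \<in> H\<close> such that \<open>L (a + h)\<close> is orthogonal to \<open>L H\<close>, and the claim is that \<open>h = 0\<close>.
  Put \<open>u = a + h\<close>; if \<open>h \<noteq> 0\<close>, complete \<open>h\<close> to an orthogonal basis of \<open>H\<close> by unit vectors \<open>y\<close>. As \<open>u\<close> and \<open>h\<close>
  are orthogonal to \<open>y\<close>, the families \<open>(h + u, y)\<close> and \<open>(h - u, y)\<close> have volumes \<open>norm (h + u)\<close> and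
  \<open>norm (h - u)\<close>. Their images under \<open>L\<close> have the same Gram matrix, because \<open>L u\<close> is orthogonal to
  \<open>L h\<close> and to all \<open>L y\<close>. So the two norms agree, that is, \<open>u\<close> and \<open>h\<close> are orthogonal; but
  \<open>inner u h = inner h h\<close>, a contradiction.\<close>

lemma unit_volume_preserving_imp_orthogonality_preserving:
  fixes L :: "'a::real_inner \<Rightarrow> 'b::real_inner" and B :: "'a set"
  assumes n: "n \<ge> 2" and B: "independent B" "card B = n + 1" and lin: "linear L"
    and vol: "\<And>v. Vol n v = 1 \<Longrightarrow> Vol n (\<lambda>i. L (v i)) = 1"
    and ab: "norm a = 1" "norm b = 1" "inner a b = 0"
  shows "inner (L a) (L b) = 0"
proof -
  have "orthonormal 2 ((\<lambda>_. a)(1 := b))"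
    using ab by (simp add: orthonormal_def numeral_2_eq_2 less_Suc_eq all_conj_distrib inner_commute
        norm_eq_1)
  then obtain e where e: "orthonormal (Suc n) e" "\<forall>i<2. e i = ((\<lambda>_. a)(1 := b)) i"
    using orthonormal_extension[of 2 "(\<lambda>_. a)(1 := b)" UNIV B "Suc n"] B n by auto
  define g where "g i = e (Suc i)" for i
  define H where "H = span (g ` {..<n})"
  have g: "orthonormal n g"
    using e(1) by (simp add: orthonormal_def g_def)
  have b: "g 0 = b" and a: "e 0 = a"
    using e(2) by (simp_all add: g_def)
  have bH: "b \<in> H"
    unfolding H_def using b n by (metis imageI lessThan_iff less_le_trans span_base zero_less_numeral)
  have aH: "inner a x = 0" if "x \<in> H" for x
  proof (rule inner_eq_0_on_span)
    show "inner a y = 0" if "y \<in> g ` {..<n}" for y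
      using that e(1) a by (auto simp: orthonormal_def g_def)
  qed (use that in \<open>simp add: H_def\<close>)
  obtain p where p: "p \<in> span (L ` g ` {..<n})" "\<forall>y\<in>L ` g ` {..<n}. inner (L a - p) y = 0"
    using orthogonal_projection_exists[of "L ` g ` {..<n}" "L a"] by auto
  then obtain h where h: "h \<in> H" "p = L (- h)"
  proof -
    obtain q where "q \<in> H" "p = L q"
      using p(1) by (auto simp: H_def linear_span_image[OF lin])
    then show thesis
      using that[of "- q"] by (simp add: H_def span_neg)
  qed
  define u where "u = a + h"
  have Lu: "inner (L u) (L x) = 0" if "x \<in> H" for x
  proof (rule inner_eq_0_on_span)
    show "L x \<in> span (L ` g ` {..<n})"
      using that by (simp add: H_def linear_span_image[OF lin])
    show "inner (L u) y = 0" if "y \<in> L ` g ` {..<n}" for y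
    proof -
      have "L u = L a - p"
        by (simp add: u_def h(2) linear_add[OF lin] linear_neg[OF lin])
      then show ?thesis
        using p(2) that by (simp only:)
    qed
  qed
  have "h = 0"
  proof (rule ccontr)
    assume h0: "h \<noteq> 0"
    have "orthonormal 1 (\<lambda>_. sgn h)"
      using h0 by (simp add: orthonormal_def norm_sgn flip: power2_norm_eq_inner)
    moreover have "sgn h \<in> H"
      using h(1) by (simp add: sgn_div_norm H_def span_scale)
    ultimately obtain f where f: "orthonormal n f" "f 0 = sgn h" "\<forall>i<n. f i \<in> H"
      using orthonormal_extension[of 1 "\<lambda>_. sgn h" H "g ` {..<n}" n] n
        orthonormal_independent[OF g] by (auto simp: H_def span_superset)
    have hf: "inner h (f i) = 0" if "i < n" "i \<noteq> 0" for i
    proof -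
      have "inner (sgn h) (f i) = 0"
        using f(1,2) that by (auto simp: orthonormal_def)
      then show ?thesis
        using h0 by (simp add: sgn_div_norm)
    qed
    \<comment> \<open>Only volume one is known to be preserved, so \<open>x\<close> is normalised before \<open>L\<close> is applied.\<close>
    have Vol_L: "Vol n (\<lambda>i. L ((f(0 := x)) i)) = norm x"
      if x: "x \<noteq> 0" "\<And>i. i < n \<Longrightarrow> i \<noteq> 0 \<Longrightarrow> inner x (f i) = 0" for x
    proof -
      let ?v = "f(0 := sgn x)"
      have "inner (sgn x) (sgn x) = 1"
        using x(1) by (simp add: norm_sgn flip: power2_norm_eq_inner)
      then have "orthonormal n ?v"
        using f(1) x(2) by (auto simp: orthonormal_def sgn_div_norm inner_commute)
      then have "Vol n (\<lambda>i. L (?v i)) = 1"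
        by (intro vol Vol_orthonormal)
      moreover have "(\<lambda>i. L ((f(0 := x)) i)) = (\<lambda>i. L (?v i))(0 := norm x *\<^sub>R L (?v 0))"
        using x(1) by (auto simp: sgn_div_norm linear_scale[OF lin])
      ultimately show ?thesis
        using n Vol_scale[of 0 n "\<lambda>i. L (?v i)" "norm x"] by simp
    qed
    have a0: "a \<noteq> 0"
      using ab(1) by auto
    have uf: "inner u (f i) = 0" if "i < n" "i \<noteq> 0" for i
      using aH f(3) hf that by (simp add: u_def inner_add_left)
    have "h + u \<noteq> 0"
    proof
      assume "h + u = 0"
      then have "inner a (h + u) = 0" by simp
      then show False
        using aH[OF h(1)] ab(1) by (simp add: u_def inner_add_right norm_eq_1)
    qed
    then have "norm (h + u) = Vol n (\<lambda>i. L ((f(0 := h + u)) i))"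
      using hf uf by (intro Vol_L[symmetric]) (auto simp: inner_add_left)
    also have "\<dots> = Vol n (\<lambda>i. L ((f(0 := h - u)) i))"
    proof (rule Vol_eqI)
      fix i j assume "i < n" "j < n"
      moreover have "inner (L x) (L u) = 0" if "x \<in> H" for x
        using Lu[OF that] by (simp add: inner_commute)
      ultimately show "inner (L ((f(0 := h + u)) i)) (L ((f(0 := h + u)) j))
          = inner (L ((f(0 := h - u)) i)) (L ((f(0 := h - u)) j))"
        using Lu h(1) f(3) by (simp add: linear_add[OF lin] linear_diff[OF lin] inner_add_left
            inner_add_right inner_diff_left inner_diff_right)
    qed
    also have "\<dots> = norm (h - u)"
      using a0 aH f(3) by (intro Vol_L) (auto simp: u_def)
    finally have "inner h u = 0"
      by (simp add: norm_eq inner_add_left inner_add_right inner_diff_left inner_diff_right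
          inner_commute)
    then show False
      using h0 aH[OF h(1)] by (simp add: u_def inner_add_right inner_commute)
  qed
  then show ?thesis
    using Lu[OF bH] by (simp add: u_def)
qed

text \<open>A linear map that preserves orthogonality stretches orthonormal vectors \<open>e\<close> and \<open>e'\<close> equally, since
  \<open>e + e'\<close> and \<open>e - e'\<close> are orthogonal. Hence the image of an orthonormal family has a scalar Gram
  matrix, with determinant one.\<close>

lemma unit_volume_preserving_imp_norm_preserving:
  fixes L :: "'a::real_inner \<Rightarrow> 'b::real_inner" and B :: "'a set"
  assumes n: "n \<ge> 2" and B: "independent B" "card B = n + 1" and lin: "linear L"
    and vol: "\<And>v. Vol n v = 1 \<Longrightarrow> Vol n (\<lambda>i. L (v i)) = 1"
  shows "norm (L x) = norm x"
proof (cases "x = 0")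
  case False
  have orth: "inner (L a) (L b) = 0" if "inner a b = 0" for a b
  proof (cases "a = 0 \<or> b = 0")
    case False
    have "inner (L (sgn a)) (L (sgn b)) = 0"
      using that False
      by (intro unit_volume_preserving_imp_orthogonality_preserving[OF n B lin vol])
        (auto simp: norm_sgn sgn_div_norm)
    then show ?thesis
      using False by (simp add: sgn_div_norm linear_scale[OF lin])
  qed (auto simp: linear_0[OF lin])
  have "orthonormal 1 (\<lambda>_. sgn x)"
    using False by (simp add: orthonormal_def norm_sgn flip: power2_norm_eq_inner)
  then obtain e where e: "orthonormal n e" "e 0 = sgn x"
    using orthonormal_extension[of 1 "\<lambda>_. sgn x" UNIV B n] B n by auto
  define k where "k = inner (L (e 0)) (L (e 0))"
  have diag: "inner (L (e i)) (L (e i)) = k" if "i < n" for i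
  proof (cases "i = 0")
    case i: False
    have "inner (e 0 + e i) (e 0 - e i) = 0"
      using e(1) that i n by (simp add: orthonormal_def inner_add_left inner_diff_right)
    then have "inner (L (e 0 + e i)) (L (e 0 - e i)) = 0"
      by (rule orth)
    then show ?thesis
      by (simp add: k_def linear_add[OF lin] linear_diff[OF lin] inner_add_left inner_diff_right
          inner_commute[of "L (e i)" "L (e 0)"])
  qed (simp add: k_def)
  have "gram n (\<lambda>i. L (e i)) = k \<cdot>\<^sub>m 1\<^sub>m n"
  proof (rule eq_matI)
    fix i j assume "i < dim_row (k \<cdot>\<^sub>m 1\<^sub>m n :: real mat)" "j < dim_col (k \<cdot>\<^sub>m 1\<^sub>m n :: real mat)"
    then show "gram n (\<lambda>i. L (e i)) $$ (i, j) = (k \<cdot>\<^sub>m 1\<^sub>m n) $$ (i, j)"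
      using e(1) orth[of "e i" "e j"] by (auto simp: diag orthonormal_def)
  qed auto
  moreover have "Vol n (\<lambda>i. L (e i)) = 1"
    by (intro vol Vol_orthonormal e)
  ultimately have "k ^ n = 1"
    by (simp add: Vol_def)
  moreover have "k \<ge> 0"
    by (simp add: k_def)
  ultimately have "k = 1"
    using n power_eq_imp_eq_base[of k n 1] by simp
  then have "norm (L (sgn x)) = 1"
    using e(2) by (simp add: k_def norm_eq_1)
  then show ?thesis
    using False by (simp add: sgn_div_norm linear_scale[OF lin] field_simps)
qed (simp add: linear_0[OF lin])

text \<open>The columns of the matrix are the coordinates of the vectors \<open>L (e j)\<close> in the basis \<open>f\<close>, so the
  family of these vectors arises from \<open>f\<close> by the substitution with the transposed matrix.\<close>

lemma unit_volume_preserving_imp_abs_det_eq_1: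
  fixes L :: "'a::real_inner \<Rightarrow> 'b::real_inner"
  assumes lin: "linear L"
    and vol: "\<And>v. Vol n v = 1 \<Longrightarrow> Vol n (\<lambda>i. L (v i)) = 1"
    and e: "orthonormal_basis n e UNIV" and f: "orthonormal_basis n f (range L)"
  shows "\<bar>det (mat n n (\<lambda>(i, j). inner (f i) (L (e j))))\<bar> = 1"
proof -
  let ?M = "mat n n (\<lambda>(i, j). inner (f i) (L (e j)))"
  have "Vol n (\<lambda>j. L (e j)) = Vol n (\<lambda>j. \<Sum>i<n. transpose_mat ?M $$ (j, i) *\<^sub>R f i)"
  proof (rule Vol_cong)
    fix j assume "j < n"
    moreover have "L (e j) = (\<Sum>i<n. inner (f i) (L (e j)) *\<^sub>R f i)"
      using f by (intro orthonormal_expansion) (auto simp: orthonormal_basis_iff)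
    ultimately show "L (e j) = (\<Sum>i<n. transpose_mat ?M $$ (j, i) *\<^sub>R f i)"
      by simp
  qed
  also have "\<dots> = \<bar>det (transpose_mat ?M)\<bar> * Vol n f"
    by (rule Vol_transform) simp
  also have "\<dots> = \<bar>det ?M\<bar>"
    using f by (simp add: det_transpose[of _ n] Vol_orthonormal orthonormal_basis_iff)
  finally show ?thesis
    using vol[OF Vol_orthonormal[of n e]] e by (simp add: orthonormal_basis_iff)
qed

theorem corollary5:
  fixes \<phi> :: "'a::real_inner \<Rightarrow> 'b::real_inner" and n :: nat
  assumes "n \<ge> 2"
    and "surj \<phi>"
    and "\<And>x :: nat \<Rightarrow> 'a.
           Vol n (\<lambda>i. x (Suc i) - x 0) = 1 \<longleftrightarrow> Vol n (\<lambda>i. \<phi> (x (Suc i)) - \<phi> (x 0)) = 1"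
  shows "((\<exists>B :: 'a set. independent B \<and> card B = n + 1) \<longrightarrow> isometry \<phi>) \<and>
         (dim (UNIV :: 'a set) = n \<longrightarrow> equiaffinity \<phi>)"
proof (intro conjI impI)
  assume "\<exists>B :: 'a set. independent B \<and> card B = n + 1"
  then obtain B :: "'a set" where B: "independent B" "card B = n + 1"
    by blast
  then obtain C where "C \<subseteq> B" "card C = n"
    using obtain_subset_with_card_n[of n B] by auto
  then have "independent C"
    using B(1) independent_mono by blast
  then interpret unit_volume_map \<phi> n
    using assms \<open>card C = n\<close> by unfold_locales blast+
  have "dist (\<phi> x) (\<phi> y) = dist x y" for x y
  proof -
    have "norm (L (x - y)) = norm (x - y)"
      using unit_volume_preserving_imp_norm_preserving[OF assms(1) B L_linear] unit_volume_L_iff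
      by blast
    then show ?thesis
      by (simp add: linear_diff[OF L_linear] dist_norm) (simp add: L_def)
  qed
  then show "isometry \<phi>"
    by (simp add: isometry_def)
next
  assume dim: "dim (UNIV :: 'a set) = n"
  obtain B :: "'a set" where B: "independent B" "UNIV \<subseteq> span B" "card B = n"
    using basis_exists[of "UNIV :: 'a set"] dim by metis
  interpret unit_volume_map \<phi> n
    using assms B(1,3) by unfold_locales blast+
  have "finite B"
    using B(3) n_ge_2 card.infinite by fastforce
  moreover have "span B = UNIV"
    using B(2) by blast
  ultimately obtain e where e: "orthonormal_basis n e (UNIV :: 'a set)"
    using orthonormal_basis_of_span[of B] B by auto
  have "Vol n (\<lambda>i. L (e i)) \<noteq> 0"
    using e unit_volume_L_iff[of e] by (simp add: orthonormal_basis_iff Vol_orthonormal)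
  note Le = Vol_nonzero_imp_independent[OF this]
  let ?C = "(\<lambda>i. L (e i)) ` {..<n}"
  have "span ?C = range L"
    using e linear_span_image[OF L_linear, of "e ` {..<n}"]
    by (simp add: orthonormal_basis_iff image_image)
  then obtain f where f: "orthonormal_basis n f (range L)"
    using orthonormal_basis_of_span[of ?C] Le by (auto simp: card_image)
  have "\<bar>det (mat n n (\<lambda>(i, j). inner (f i) (L (e j))))\<bar> = 1"
    using unit_volume_preserving_imp_abs_det_eq_1[OF L_linear _ e f] unit_volume_L_iff by blast
  moreover have "\<forall>x. \<phi> x = L x + \<phi> 0"
    by (simp add: L_def)
  ultimately show "equiaffinity \<phi>"
    unfolding equiaffinity_def using L_linear e f by blast
qed

end
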